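(* Let $G$ be a topological group and let $p\colon E\to B$ be a $G$-fibration such that $G$ acts freely on $B$. If $K$ is a subgroup of $G$ such that $p\colon E\to B$ is also a $K$-fibration, then $$\mathrm{TC}^{K}[p\colon E\to B]\le\mathrm{TC}^{G}[p\colon E\to B].$$
   Context: All spaces are Hausdorff, $I=[0,1]$, path spaces carry the compact-open topology. A $G$-map is a continuous equivariant map; a $G$-homotopy is an equivariant homotopy ($G$ acting trivially on $I$). A $G$-fibration is a $G$-map with the $G$-homotopy lifting property with respect to every $G$-space. Equivariant sectional category: for a $G$-map $q\colon X\to Y$, $\mathrm{secat}_G(q)$ is the least positive integer $k$ such that $Y$ has a cover by $G$-invariant open sets $U_1,\dots,U_k$ with $G$-maps $s_i\colon U_i\to X$ such that $q\circ s_i$ is $G$-homotopic to the inclusion $U_i\hookrightarrow Y$ ($\infty$ if there is no such $k$). Invariant parametrized topological complexity: for a $G$-fibration $p\colon E\to B$, let $E^I_B$ be the space of paths $\gamma\colon I\to E$ whose image lies in a single fibre of $p$, with $(g\cdot\gamma)(t)=g\cdot\gamma(t)$. Put $E^I_B\times_{E/G}E^I_B=\{(\gamma,\delta)\in E^I_B\times E^I_B : G\cdot\gamma(1)=G\cdot\delta(0)\}$ and $E\times_{B/G}E=\{(e_1,e_2)\in E\times E : G\cdot p(e_1)=G\cdot p(e_2)\}$, with the componentwise $(G\times G)$-actions, and let $\Psi(\gamma,\delta)=(\gamma(0),\delta(1))$, a $(G\times G)$-fibration $E^I_B\times_{E/G}E^I_B\to E\times_{B/G}E$. Then $\mathrm{TC}^G[p\colon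 E\to B]:=\mathrm{secat}_{G\times G}(\Psi)$. The number $\mathrm{TC}^K[p\colon E\to B]$ is defined in the same way with $K$ in place of $G$.
   Formalization: The formal theorem assumes explicitly that Ψ is a (G×G)-fibration, as the definition of TC^G asserts; for arbitrary topological groups this can fail, and the inequality is then false (e.g. discrete ℝ acting by translation on B=ℝ, with E=ℝ×ℝ_discrete and K trivial). *)

theory Defs
  imports "HOL-Analysis.Analysis" "HOL-Algebra.Group_Action" "HOL-Library.Extended_Nat"
begin

section \<open>Topological groups and G-spaces\<close>

definition topological_group :: "('g, 'm) monoid_scheme \<Rightarrow> 'g topology \<Rightarrow> bool" where
  "topological_group G TG \<longleftrightarrow>
     group G \<and> topspace TG = carrier G \<and> Hausdorff_space TG \<and>
     continuous_map (prod_topology TG TG) TG (\<lambda>(g, h). g \<otimes>\<^bsub>G\<^esub> h) \<and>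
     continuous_map TG TG (\<lambda>g. inv\<^bsub>G\<^esub> g)"

text \<open>The library's \<open>group_action\<close> makes each \<open>\<phi> g\<close> a member of \<open>Bij (topspace X)\<close>, hence
  \<open>undefined\<close> off \<open>topspace X\<close>; this is why the actions constructed below are restricted.\<close>

definition G_space ::
  "('g, 'm) monoid_scheme \<Rightarrow> 'g topology \<Rightarrow> 'x topology \<Rightarrow> ('g \<Rightarrow> 'x \<Rightarrow> 'x) \<Rightarrow> bool" where
  "G_space G TG X \<phi> \<longleftrightarrow>
     Hausdorff_space X \<and> group_action G (topspace X) \<phi> \<and>
     continuous_map (prod_topology TG X) X (\<lambda>(g, x). \<phi> g x)"

definition equivariant ::
  "('g, 'm) monoid_scheme \<Rightarrow> 'x set \<Rightarrow> ('g \<Rightarrow> 'x \<Rightarrow> 'x) \<Rightarrow> ('g \<Rightarrow> 'y \<Rightarrow> 'y) \<Rightarrow> ('x \<Rightarrow> 'y) \<Rightarrow> bool" where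
  "equivariant G S \<phi> \<psi> f \<longleftrightarrow> (\<forall>g\<in>carrier G. \<forall>x\<in>S. f (\<phi> g x) = \<psi> g (f x))"

definition G_map ::
  "('g, 'm) monoid_scheme \<Rightarrow> 'x topology \<Rightarrow> ('g \<Rightarrow> 'x \<Rightarrow> 'x) \<Rightarrow>
     'y topology \<Rightarrow> ('g \<Rightarrow> 'y \<Rightarrow> 'y) \<Rightarrow> ('x \<Rightarrow> 'y) \<Rightarrow> bool" where
  "G_map G X \<phi> Y \<psi> f \<longleftrightarrow> continuous_map X Y f \<and> equivariant G (topspace X) \<phi> \<psi> f"

abbreviation I_top :: "real topology" where
  "I_top \<equiv> top_of_set {0..1}"

definition G_homotopy ::
  "('g, 'm) monoid_scheme \<Rightarrow> 'x topology \<Rightarrow> ('g \<Rightarrow> 'x \<Rightarrow> 'x) \<Rightarrow>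
     'y topology \<Rightarrow> ('g \<Rightarrow> 'y \<Rightarrow> 'y) \<Rightarrow> (real \<times> 'x \<Rightarrow> 'y) \<Rightarrow> bool" where
  "G_homotopy G X \<phi> Y \<psi> h \<longleftrightarrow> G_map G (prod_topology I_top X) (\<lambda>g (t, x). (t, \<phi> g x)) Y \<psi> h"

section \<open>G-fibrations\<close>

definition G_HLP ::
  "('g, 'm) monoid_scheme \<Rightarrow> 'e topology \<Rightarrow> ('g \<Rightarrow> 'e \<Rightarrow> 'e) \<Rightarrow> 'b topology \<Rightarrow> ('g \<Rightarrow> 'b \<Rightarrow> 'b) \<Rightarrow>
     ('e \<Rightarrow> 'b) \<Rightarrow> 'z topology \<Rightarrow> ('g \<Rightarrow> 'z \<Rightarrow> 'z) \<Rightarrow> bool" where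
  "G_HLP G E \<phi> B \<psi> p Z \<zeta> \<longleftrightarrow>
     (\<forall>f h. G_map G Z \<zeta> E \<phi> f \<and> G_homotopy G Z \<zeta> B \<psi> h \<and> (\<forall>z\<in>topspace Z. h (0, z) = p (f z)) \<longrightarrow>
        (\<exists>k. G_homotopy G Z \<zeta> E \<phi> k \<and> (\<forall>z\<in>topspace Z. k (0, z) = f z) \<and>
             (\<forall>t\<in>{0..1}. \<forall>z\<in>topspace Z. p (k (t, z)) = h (t, z))))"

text \<open>HOL cannot quantify over types inside a formula, so the test spaces range over all
  \<open>G\<close>-spaces carried by subsets of the type \<open>'e \<times> (real \<Rightarrow> 'b)\<close>. This is no restriction: that
  type holds the equivariant mapping path space of \<open>p\<close>, and \<open>G_fibration_HLP\<close> below derives the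
  lifting property for \<open>G\<close>-spaces over an arbitrary type.\<close>

definition G_fibration ::
  "('g, 'm) monoid_scheme \<Rightarrow> 'g topology \<Rightarrow> 'e topology \<Rightarrow> ('g \<Rightarrow> 'e \<Rightarrow> 'e) \<Rightarrow>
     'b topology \<Rightarrow> ('g \<Rightarrow> 'b \<Rightarrow> 'b) \<Rightarrow> ('e \<Rightarrow> 'b) \<Rightarrow> bool" where
  "G_fibration G TG E \<phi> B \<psi> p \<longleftrightarrow>
     G_space G TG E \<phi> \<and> G_space G TG B \<psi> \<and> G_map G E \<phi> B \<psi> p \<and>
     (\<forall>(Z :: ('e \<times> (real \<Rightarrow> 'b)) topology) \<zeta>. G_space G TG Z \<zeta> \<longrightarrow> G_HLP G E \<phi> B \<psi> p Z \<zeta>)"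

section \<open>Equivariant sectional category\<close>

text \<open>An infimum in \<open>enat\<close>: it is attained when the set is nonempty, and \<open>Inf {} = \<infinity>\<close>.\<close>

definition secat ::
  "('g, 'm) monoid_scheme \<Rightarrow> 'x topology \<Rightarrow> ('g \<Rightarrow> 'x \<Rightarrow> 'x) \<Rightarrow>
     'y topology \<Rightarrow> ('g \<Rightarrow> 'y \<Rightarrow> 'y) \<Rightarrow> ('x \<Rightarrow> 'y) \<Rightarrow> enat" where
  "secat G X \<phi> Y \<psi> q = Inf {enat k | k. k > 0 \<and>
     (\<exists>U s. (\<Union>i<k. U i) = topspace Y \<and>
        (\<forall>i<k. openin Y (U i) \<and> (\<forall>g\<in>carrier G. \<psi> g ` U i \<subseteq> U i) \<and>
           G_map G (subtopology Y (U i)) \<psi> X \<phi> (s i) \<and>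
           homotopic_with (equivariant G (U i) \<psi> \<psi>) (subtopology Y (U i)) Y (q \<circ> s i) id))}"

section \<open>Invariant parametrized topological complexity\<close>

text \<open>The compact-open topology. Maps are taken extensional, so that they are determined by their
  values on \<open>topspace X\<close>; the choice \<open>C = {}\<close> puts every continuous map into the space.\<close>

definition mapping_space :: "'x topology \<Rightarrow> 'y topology \<Rightarrow> ('x \<Rightarrow> 'y) topology" where
  "mapping_space X Y = topology_generated_by
     {{f \<in> extensional (topspace X). continuous_map X Y f \<and> f ` C \<subseteq> U} | C U.
        compactin X C \<and> openin Y U}"

definition fibre_paths :: "'e topology \<Rightarrow> 'b topology \<Rightarrow> ('e \<Rightarrow> 'b) \<Rightarrow> (real \<Rightarrow> 'e) topology" where
  "fibre_paths E B p = subtopology (mapping_space I_top E)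
     {\<gamma>. \<exists>b\<in>topspace B. \<forall>t\<in>{0..1}. p (\<gamma> t) = b}"

definition path_action :: "('g \<Rightarrow> 'e \<Rightarrow> 'e) \<Rightarrow> 'g \<Rightarrow> (real \<Rightarrow> 'e) \<Rightarrow> real \<Rightarrow> 'e" where
  "path_action \<phi> g \<gamma> = (\<lambda>t\<in>{0..1}. \<phi> g (\<gamma> t))"

definition prod_action ::
  "('x \<times> 'x) set \<Rightarrow> ('g \<Rightarrow> 'x \<Rightarrow> 'x) \<Rightarrow> 'g \<times> 'g \<Rightarrow> 'x \<times> 'x \<Rightarrow> 'x \<times> 'x" where
  "prod_action S \<phi> gh = restrict (\<lambda>(x, y). (\<phi> (fst gh) x, \<phi> (snd gh) y)) S"

text \<open>\<open>inv_path_space\<close> is the total space and \<open>inv_base_space\<close> the base space of \<open>\<Psi>\<close>;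
  two points lie in one orbit iff their \<open>orbit\<close> sets are equal.\<close>

definition inv_path_space ::
  "('g, 'm) monoid_scheme \<Rightarrow> 'e topology \<Rightarrow> ('g \<Rightarrow> 'e \<Rightarrow> 'e) \<Rightarrow> 'b topology \<Rightarrow> ('e \<Rightarrow> 'b) \<Rightarrow>
     ((real \<Rightarrow> 'e) \<times> (real \<Rightarrow> 'e)) topology" where
  "inv_path_space G E \<phi> B p = subtopology (prod_topology (fibre_paths E B p) (fibre_paths E B p))
     {(\<gamma>, \<delta>). orbit G \<phi> (\<gamma> 1) = orbit G \<phi> (\<delta> 0)}"

definition inv_base_space ::
  "('g, 'm) monoid_scheme \<Rightarrow> 'e topology \<Rightarrow> ('g \<Rightarrow> 'b \<Rightarrow> 'b) \<Rightarrow> ('e \<Rightarrow> 'b) \<Rightarrow> ('e \<times> 'e) topology" where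
  "inv_base_space G E \<psi> p = subtopology (prod_topology E E)
     {(e1, e2). orbit G \<psi> (p e1) = orbit G \<psi> (p e2)}"

definition inv_path_action ::
  "('g, 'm) monoid_scheme \<Rightarrow> 'e topology \<Rightarrow> ('g \<Rightarrow> 'e \<Rightarrow> 'e) \<Rightarrow> 'b topology \<Rightarrow> ('e \<Rightarrow> 'b) \<Rightarrow>
     'g \<times> 'g \<Rightarrow> (real \<Rightarrow> 'e) \<times> (real \<Rightarrow> 'e) \<Rightarrow> (real \<Rightarrow> 'e) \<times> (real \<Rightarrow> 'e)" where
  "inv_path_action G E \<phi> B p = prod_action (topspace (inv_path_space G E \<phi> B p)) (path_action \<phi>)"

definition inv_base_action ::
  "('g, 'm) monoid_scheme \<Rightarrow> 'e topology \<Rightarrow> ('g \<Rightarrow> 'e \<Rightarrow> 'e) \<Rightarrow> ('g \<Rightarrow> 'b \<Rightarrow> 'b) \<Rightarrow> ('e \<Rightarrow> 'b) \<Rightarrow>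
     'g \<times> 'g \<Rightarrow> 'e \<times> 'e \<Rightarrow> 'e \<times> 'e" where
  "inv_base_action G E \<phi> \<psi> p = prod_action (topspace (inv_base_space G E \<psi> p)) \<phi>"

definition Psi :: "(real \<Rightarrow> 'e) \<times> (real \<Rightarrow> 'e) \<Rightarrow> 'e \<times> 'e" where
  "Psi = (\<lambda>(\<gamma>, \<delta>). (\<gamma> 0, \<delta> 1))"

text \<open>That \<open>\<Psi>\<close> is a \<open>(G \<times> G)\<close>-fibration is part of the setting of \<open>invTC\<close>, but it does not
  follow from \<open>G_fibration\<close> for arbitrary topological groups, even when \<open>G\<close> acts freely on \<open>B\<close>:
  the group element relating \<open>p e1\<close> to \<open>p e2\<close> need not depend continuously on \<open>(e1, e2)\<close>.
  For instance, let \<open>G = E' = \<real>\<close> be discrete, \<open>B = \<real>\<close> with its usual topology and translation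
  action, \<open>E = B \<times> E'\<close> with diagonal action, and \<open>p\<close> the projection.\<close>

definition Psi_fibration ::
  "('g, 'm) monoid_scheme \<Rightarrow> 'g topology \<Rightarrow> 'e topology \<Rightarrow> ('g \<Rightarrow> 'e \<Rightarrow> 'e) \<Rightarrow>
     'b topology \<Rightarrow> ('g \<Rightarrow> 'b \<Rightarrow> 'b) \<Rightarrow> ('e \<Rightarrow> 'b) \<Rightarrow> bool" where
  "Psi_fibration G TG E \<phi> B \<psi> p \<longleftrightarrow>
     G_fibration (G \<times>\<times> G) (prod_topology TG TG)
       (inv_path_space G E \<phi> B p) (inv_path_action G E \<phi> B p)
       (inv_base_space G E \<psi> p) (inv_base_action G E \<phi> \<psi> p) Psi"

definition invTC ::
  "('g, 'm) monoid_scheme \<Rightarrow> 'e topology \<Rightarrow> ('g \<Rightarrow> 'e \<Rightarrow> 'e) \<Rightarrow>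
     'b topology \<Rightarrow> ('g \<Rightarrow> 'b \<Rightarrow> 'b) \<Rightarrow> ('e \<Rightarrow> 'b) \<Rightarrow> enat" where
  "invTC G E \<phi> B \<psi> p = secat (G \<times>\<times> G)
     (inv_path_space G E \<phi> B p) (inv_path_action G E \<phi> B p)
     (inv_base_space G E \<psi> p) (inv_base_action G E \<phi> \<psi> p) Psi"

section \<open>Adequacy of the definitions\<close>

lemma G_spaceI:
  assumes "group G" "Hausdorff_space X"
    and closed: "\<And>g x. g \<in> carrier G \<Longrightarrow> x \<in> topspace X \<Longrightarrow> \<phi> g x \<in> topspace X"
    and ext: "\<And>g. g \<in> carrier G \<Longrightarrow> \<phi> g \<in> extensional (topspace X)"
    and one: "\<And>x. x \<in> topspace X \<Longrightarrow> \<phi> \<one>\<^bsub>G\<^esub> x = x"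
    and mult: "\<And>g h x. g \<in> carrier G \<Longrightarrow> h \<in> carrier G \<Longrightarrow> x \<in> topspace X \<Longrightarrow>
                 \<phi> (g \<otimes>\<^bsub>G\<^esub> h) x = \<phi> g (\<phi> h x)"
    and "continuous_map (prod_topology TG X) X (\<lambda>(g, x). \<phi> g x)"
  shows "G_space G TG X \<phi>"
proof -
  interpret group G by fact
  have bij: "\<phi> g \<in> Bij (topspace X)" if g: "g \<in> carrier G" for g
  proof -
    have "bij_betw (\<phi> g) (topspace X) (topspace X)"
    proof (rule bij_betwI[where g = "\<phi> (inv\<^bsub>G\<^esub> g)"])
      show "\<phi> (inv\<^bsub>G\<^esub> g) (\<phi> g x) = x" if "x \<in> topspace X" for x
        using mult[of "inv\<^bsub>G\<^esub> g" g x] g that one by simp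
      show "\<phi> g (\<phi> (inv\<^bsub>G\<^esub> g) x) = x" if "x \<in> topspace X" for x
        using mult[of g "inv\<^bsub>G\<^esub> g" x] g that one by simp
    qed (use g closed in auto)
    then show ?thesis using ext g by (simp add: Bij_def)
  qed
  have "\<phi> \<in> hom G (BijGroup (topspace X))"
  proof (rule homI)
    fix g h assume gh: "g \<in> carrier G" "h \<in> carrier G"
    have "\<phi> (g \<otimes>\<^bsub>G\<^esub> h) = compose (topspace X) (\<phi> g) (\<phi> h)"
    proof (rule extensionalityI[of _ "topspace X"])
      fix x assume "x \<in> topspace X"
      then show "\<phi> (g \<otimes>\<^bsub>G\<^esub> h) x = compose (topspace X) (\<phi> g) (\<phi> h) x"
        using gh mult by (simp add: compose_def)
    qed (use gh ext in auto)
    then show "\<phi> (g \<otimes>\<^bsub>G\<^esub> h) = \<phi> g \<otimes>\<^bsub>BijGroup (topspace X)\<^esub> \<phi> h"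
      using gh bij by (simp add: BijGroup_def)
  qed (use bij in \<open>simp add: BijGroup_def\<close>)
  then have "group_action G (topspace X) \<phi>"
    unfolding group_action_def group_hom_def group_hom_axioms_def
    using group_BijGroup by (simp add: is_group)
  then show ?thesis unfolding G_space_def using assms by blast
qed

lemma G_spaceD:
  assumes "G_space G TG X \<phi>"
  shows "group G" "Hausdorff_space X"
    "\<And>g x. g \<in> carrier G \<Longrightarrow> x \<in> topspace X \<Longrightarrow> \<phi> g x \<in> topspace X"
    "\<And>g. g \<in> carrier G \<Longrightarrow> \<phi> g \<in> extensional (topspace X)"
    "\<And>x. x \<in> topspace X \<Longrightarrow> \<phi> \<one>\<^bsub>G\<^esub> x = x"
    "\<And>g h x. g \<in> carrier G \<Longrightarrow> h \<in> carrier G \<Longrightarrow> x \<in> topspace X \<Longrightarrow>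
                 \<phi> (g \<otimes>\<^bsub>G\<^esub> h) x = \<phi> g (\<phi> h x)"
    "continuous_map (prod_topology TG X) X (\<lambda>(g, x). \<phi> g x)"
proof -
  have ga: "group_action G (topspace X) \<phi>" and H: "Hausdorff_space X"
    and c: "continuous_map (prod_topology TG X) X (\<lambda>(g, x). \<phi> g x)"
    using assms by (auto simp: G_space_def)
  interpret group_action G "topspace X" \<phi> by fact
  show "group G" using group_hom group_hom.axioms(1) by blast
  show "Hausdorff_space X" by fact
  show "\<phi> g x \<in> topspace X" if "g \<in> carrier G" "x \<in> topspace X" for g x
    using that element_image by blast
  show "\<phi> g \<in> extensional (topspace X)" if "g \<in> carrier G" for g
    using bij_prop0[OF that] by (simp add: Bij_def)
  show "\<phi> \<one>\<^bsub>G\<^esub> x = x" if "x \<in> topspace X" for x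
    using id_eq_one that by (metis restrict_apply')
  show "\<phi> (g \<otimes>\<^bsub>G\<^esub> h) x = \<phi> g (\<phi> h x)"
    if "g \<in> carrier G" "h \<in> carrier G" "x \<in> topspace X" for g h x
    using that composition_rule by blast
  show "continuous_map (prod_topology TG X) X (\<lambda>(g, x). \<phi> g x)" by fact
qed

lemma continuous_map_binop:
  assumes "continuous_map (prod_topology X Y) Z (\<lambda>(x, y). F x y)"
    and "continuous_map W X f" "continuous_map W Y g"
  shows "continuous_map W Z (\<lambda>w. F (f w) (g w))"
  using continuous_map_compose[OF continuous_map_pairedI[OF assms(2,3)] assms(1)]
  by (simp add: o_def)

lemma G_space_subtopology:
  assumes X: "G_space G TG X \<phi>" and T: "topspace TG = carrier G"
    and S: "\<And>g x. g \<in> carrier G \<Longrightarrow> x \<in> topspace X \<Longrightarrow> x \<in> S \<Longrightarrow> \<phi> g x \<in> S"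
    and eq: "\<And>g x. g \<in> carrier G \<Longrightarrow> x \<in> topspace X \<Longrightarrow> x \<in> S \<Longrightarrow> \<phi>' g x = \<phi> g x"
    and ext: "\<And>g. g \<in> carrier G \<Longrightarrow> \<phi>' g \<in> extensional (topspace X \<inter> S)"
  shows "G_space G TG (subtopology X S) \<phi>'"
proof (rule G_spaceI)
  note D = G_spaceD[OF X]
  interpret group G by (rule D(1))
  show "group G" by (rule D(1))
  show "Hausdorff_space (subtopology X S)" using D(2) by (rule Hausdorff_space_subtopology)
  show "\<phi>' g x \<in> topspace (subtopology X S)"
    if "g \<in> carrier G" "x \<in> topspace (subtopology X S)" for g x
    using that eq S D(3) by auto
  show "\<phi>' \<one>\<^bsub>G\<^esub> x = x" if "x \<in> topspace (subtopology X S)" for x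
    using that eq D(5) by auto
  show "\<phi>' (g \<otimes>\<^bsub>G\<^esub> h) x = \<phi>' g (\<phi>' h x)"
    if "g \<in> carrier G" "h \<in> carrier G" "x \<in> topspace (subtopology X S)" for g h x
    using that eq S D(3) D(6) by auto
  show "\<phi>' g \<in> extensional (topspace (subtopology X S))" if "g \<in> carrier G" for g
    using ext[OF that] by simp
  have "continuous_map (prod_topology TG (subtopology X S)) X (\<lambda>(g, x). \<phi> g x)"
    using continuous_map_from_subtopology[OF D(7), of "topspace TG \<times> S"]
    by (simp add: prod_topology_subtopology)
  then have "continuous_map (prod_topology TG (subtopology X S)) X (\<lambda>(g, x). \<phi>' g x)"
    by (rule continuous_map_eq) (use T eq in auto)
  then show "continuous_map (prod_topology TG (subtopology X S)) (subtopology X S) (\<lambda>(g, x). \<phi>' g x)"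
    by (rule continuous_map_into_subtopology) (use T eq S in auto)
qed

lemma mapping_space_union:
  "\<Union>{{f \<in> extensional (topspace X). continuous_map X Y f \<and> f ` C \<subseteq> U} | C U.
        compactin X C \<and> openin Y U} = {f \<in> extensional (topspace X). continuous_map X Y f}"
  (is "?L = ?R")
proof
  show "?L \<subseteq> ?R" by blast
  have "?R = {f \<in> extensional (topspace X). continuous_map X Y f \<and> f ` {} \<subseteq> {}}" by simp
  moreover have "compactin X {}" "openin Y {}" by simp_all
  ultimately show "?R \<subseteq> ?L" by blast
qed

lemma topspace_mapping_space:
  "topspace (mapping_space X Y) = {f \<in> extensional (topspace X). continuous_map X Y f}"
  unfolding mapping_space_def topology_generated_by_topspace by (rule mapping_space_union)

lemma openin_mapping_space_basic:
  assumes "compactin X C" "openin Y U"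
  shows "openin (mapping_space X Y) {f \<in> extensional (topspace X). continuous_map X Y f \<and> f ` C \<subseteq> U}"
  unfolding mapping_space_def by (rule topology_generated_by_Basis) (use assms in blast)

lemma Hausdorff_mapping_space:
  assumes "Hausdorff_space Y"
  shows "Hausdorff_space (mapping_space X Y)"
  unfolding Hausdorff_space_def
proof (intro allI impI)
  fix f g assume A: "f \<in> topspace (mapping_space X Y) \<and> g \<in> topspace (mapping_space X Y) \<and> f \<noteq> g"
  then have f: "f \<in> extensional (topspace X)" "continuous_map X Y f"
    and g: "g \<in> extensional (topspace X)" "continuous_map X Y g"
    by (auto simp: topspace_mapping_space)
  then obtain x where x: "x \<in> topspace X" "f x \<noteq> g x"
    using A extensionalityI by metis
  have "f x \<in> topspace Y" "g x \<in> topspace Y"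
    using f g x by (auto simp: continuous_map_def)
  then obtain U V where UV: "openin Y U" "openin Y V" "f x \<in> U" "g x \<in> V" "disjnt U V"
    using assms x(2) unfolding Hausdorff_space_def by metis
  have C: "compactin X {x}" using x by simp
  let ?W = "\<lambda>U. {f \<in> extensional (topspace X). continuous_map X Y f \<and> f ` {x} \<subseteq> U}"
  have "openin (mapping_space X Y) (?W U)" "openin (mapping_space X Y) (?W V)"
    by (rule openin_mapping_space_basic[OF C]; rule UV)+
  moreover have "f \<in> ?W U" "g \<in> ?W V" "disjnt (?W U) (?W V)"
    using UV f g by (auto simp: disjnt_def)
  ultimately show "\<exists>U V. openin (mapping_space X Y) U \<and> openin (mapping_space X Y) V \<and>
      f \<in> U \<and> g \<in> V \<and> disjnt U V" by (intro exI[of _ "?W U"] exI[of _ "?W V"] conjI)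
qed

lemma continuous_map_eval:
  assumes "Hausdorff_space X" "locally_compact_space X"
  shows "continuous_map (prod_topology X (mapping_space X Y)) Y (\<lambda>(x, f). f x)"
  unfolding continuous_map_alt
proof (intro conjI allI impI)
  show "(\<lambda>(x, f). f x) \<in> topspace (prod_topology X (mapping_space X Y)) \<rightarrow> topspace Y"
    by (auto simp: topspace_mapping_space continuous_map_def)
next
  fix U assume U: "openin Y U"
  show "openin (prod_topology X (mapping_space X Y))
          ((\<lambda>(x, f). f x) -` U \<inter> topspace (prod_topology X (mapping_space X Y)))"
  proof (subst openin_subopen, clarify)
    fix x f assume "f x \<in> U" and "(x, f) \<in> topspace (prod_topology X (mapping_space X Y))"
    then have x: "x \<in> topspace X" and f: "f \<in> extensional (topspace X)" "continuous_map X Y f"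
      by (auto simp: topspace_mapping_space)
    have W: "openin X {x \<in> topspace X. f x \<in> U}"
      using f(2) U by (simp add: continuous_map_def)
    have nb: "neighbourhood_base_of (compactin X) X"
      using assms locally_compact_space_neighbourhood_base by blast
    have xW: "x \<in> {x \<in> topspace X. f x \<in> U}" using x \<open>f x \<in> U\<close> by simp
    obtain V C where VC: "openin X V" "compactin X C" "x \<in> V" "V \<subseteq> C"
        "C \<subseteq> {x \<in> topspace X. f x \<in> U}"
      using nb[unfolded neighbourhood_base_of, rule_format, OF conjI[OF W xW]] by blast
    let ?F = "{f \<in> extensional (topspace X). continuous_map X Y f \<and> f ` C \<subseteq> U}"
    have "openin (prod_topology X (mapping_space X Y)) (V \<times> ?F)"
      using VC(1) openin_mapping_space_basic[OF VC(2) U] by (simp add: openin_prod_Times_iff)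
    moreover have "(x, f) \<in> V \<times> ?F" using VC f by auto
    moreover have "V \<times> ?F \<subseteq> (\<lambda>(x, f). f x) -` U \<inter> topspace (prod_topology X (mapping_space X Y))"
      using VC(4) openin_subset[OF VC(1)]
      by (fastforce simp: topspace_mapping_space)
    ultimately show "\<exists>T. openin (prod_topology X (mapping_space X Y)) T \<and> (x, f) \<in> T \<and>
        T \<subseteq> (\<lambda>(x, f). f x) -` U \<inter> topspace (prod_topology X (mapping_space X Y))"
      by blast
  qed
qed

lemma continuous_map_curry:
  assumes h: "continuous_map (prod_topology X Z) Y h"
  shows "continuous_map Z (mapping_space X Y) (\<lambda>z. \<lambda>x\<in>topspace X. h (x, z))"
proof -
  have c: "continuous_map X Y (\<lambda>x\<in>topspace X. h (x, z))" if "z \<in> topspace Z" for z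
  proof -
    have "continuous_map X Y (\<lambda>x. h (x, z))"
      using continuous_map_compose[OF continuous_map_pairedI[OF continuous_map_id] h, of "\<lambda>_. z"] that
      by (simp add: o_def)
    then show ?thesis by (rule continuous_map_eq) auto
  qed
  show ?thesis
    unfolding mapping_space_def
  proof (rule continuous_on_generated_topo)
    show "(\<lambda>z. \<lambda>x\<in>topspace X. h (x, z)) ` topspace Z \<subseteq>
      \<Union>{{f \<in> extensional (topspace X). continuous_map X Y f \<and> f ` C \<subseteq> U} | C U.
        compactin X C \<and> openin Y U}"
      unfolding mapping_space_union using c by auto
  next
    fix S assume "S \<in> {{f \<in> extensional (topspace X). continuous_map X Y f \<and> f ` C \<subseteq> U} | C U.
        compactin X C \<and> openin Y U}"
    then obtain C U where C: "compactin X C" and U: "openin Y U"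
      and S: "S = {f \<in> extensional (topspace X). continuous_map X Y f \<and> f ` C \<subseteq> U}" by blast
    have CX: "C \<subseteq> topspace X" using C by (rule compactin_subset_topspace)
    have W: "openin (prod_topology X Z) {w \<in> topspace (prod_topology X Z). h w \<in> U}"
      using h U by (simp add: continuous_map_def)
    show "openin Z ((\<lambda>z. \<lambda>x\<in>topspace X. h (x, z)) -` S \<inter> topspace Z)"
    proof (subst openin_subopen, clarify)
      fix z assume z: "(\<lambda>x\<in>topspace X. h (x, z)) \<in> S" "z \<in> topspace Z"
      then have "C \<times> {z} \<subseteq> {w \<in> topspace (prod_topology X Z). h w \<in> U}"
        using CX by (auto simp: S)
      then obtain A V where AV: "openin X A" "openin Z V" "C \<subseteq> A" "z \<in> V"
          "A \<times> V \<subseteq> {w \<in> topspace (prod_topology X Z). h w \<in> U}"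
        using tube_lemma_left[OF W C z(2)] by blast
      have "V \<subseteq> (\<lambda>z. \<lambda>x\<in>topspace X. h (x, z)) -` S \<inter> topspace Z"
        using AV CX c openin_subset[OF AV(2)] by (auto simp: S image_subset_iff subset_iff)
      then show "\<exists>T. openin Z T \<and> z \<in> T \<and> T \<subseteq> (\<lambda>z. \<lambda>x\<in>topspace X. h (x, z)) -` S \<inter> topspace Z"
        using AV by blast
    qed
  qed
qed

lemma I_top_props: "Hausdorff_space I_top" "locally_compact_space I_top" 
  by (auto simp: Hausdorff_space_subtopology compact_imp_locally_compact_space compact_space_subtopology)

lemma G_space_paths:
  assumes X: "G_space G TG X \<phi>" and T: "topspace TG = carrier G"
  shows "G_space G TG (mapping_space I_top X)
           (\<lambda>g. restrict (path_action \<phi> g) (topspace (mapping_space I_top X)))"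
    (is "G_space G TG ?M ?a")
proof -
  note D = G_spaceD[OF X]
  interpret group G by (rule D(1))
  have pt: "\<gamma> t \<in> topspace X" if "\<gamma> \<in> topspace ?M" "t \<in> {0..1}" for \<gamma> t
    using that by (auto simp: topspace_mapping_space continuous_map_def)
  have "continuous_map (prod_topology I_top (prod_topology TG ?M)) X
          (\<lambda>w. \<phi> (fst (snd w)) ((\<lambda>(t, \<gamma>). \<gamma> t) (fst w, snd (snd w))))"
  proof (rule continuous_map_binop[OF D(7)])
    show "continuous_map (prod_topology I_top (prod_topology TG ?M)) TG (\<lambda>w. fst (snd w))"
      using continuous_map_compose[OF continuous_map_snd continuous_map_fst] by (simp add: o_def)
    have "continuous_map (prod_topology I_top (prod_topology TG ?M)) ?M (\<lambda>w. snd (snd w))"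
      using continuous_map_compose[OF continuous_map_snd continuous_map_snd] by (simp add: o_def)
    then have "continuous_map (prod_topology I_top (prod_topology TG ?M)) (prod_topology I_top ?M)
       (\<lambda>w. (fst w, snd (snd w)))"
      by (intro continuous_map_pairedI continuous_map_fst)
    from continuous_map_compose[OF this continuous_map_eval[OF I_top_props]]
    show "continuous_map (prod_topology I_top (prod_topology TG ?M)) X
       (\<lambda>w. (\<lambda>(t, \<gamma>). \<gamma> t) (fst w, snd (snd w)))" by (simp add: o_def)
  qed
  from continuous_map_curry[OF this]
  have "continuous_map (prod_topology TG ?M) ?M (\<lambda>(g, \<gamma>). path_action \<phi> g \<gamma>)"
    by (simp add: path_action_def case_prod_unfold)
  then have c: "continuous_map (prod_topology TG ?M) ?M (\<lambda>(g, \<gamma>). ?a g \<gamma>)"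
    by (rule continuous_map_eq) auto
  show ?thesis
  proof (rule G_spaceI)
    show cl: "?a g \<gamma> \<in> topspace ?M" if "g \<in> carrier G" "\<gamma> \<in> topspace ?M" for g \<gamma>
      using funcset_mem[OF continuous_map_funspace[OF c], of "(g, \<gamma>)"] that T by simp
    show "?a \<one>\<^bsub>G\<^esub> \<gamma> = \<gamma>" if "\<gamma> \<in> topspace ?M" for \<gamma>
    proof -
      have "\<gamma> \<in> extensional {0..1}" using that by (auto simp: topspace_mapping_space)
      then show ?thesis using that pt D(5)
        by (auto simp: path_action_def fun_eq_iff extensional_def)
    qed
    show "?a (g \<otimes>\<^bsub>G\<^esub> h) \<gamma> = ?a g (?a h \<gamma>)"
      if "g \<in> carrier G" "h \<in> carrier G" "\<gamma> \<in> topspace ?M" for g h \<gamma>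
    proof -
      have "?a g (?a h \<gamma>) = path_action \<phi> g (path_action \<phi> h \<gamma>)"
        using cl[OF that(2,3)] that(3) by simp
      then show ?thesis using that pt D(6)
        by (auto simp: path_action_def fun_eq_iff)
    qed
  qed (use D c in \<open>auto intro: Hausdorff_mapping_space\<close>)
qed

lemma G_space_diag:
  assumes X: "G_space G TG X \<phi>" and Y: "G_space G TG Y \<psi>" and T: "topspace TG = carrier G"
  shows "G_space G TG (prod_topology X Y)
           (\<lambda>g. restrict (\<lambda>(x, y). (\<phi> g x, \<psi> g y)) (topspace X \<times> topspace Y))"
    (is "G_space G TG ?P ?a")
proof (rule G_spaceI)
  note D = G_spaceD[OF X] and D' = G_spaceD[OF Y]
  interpret group G by (rule D(1))
  have "continuous_map (prod_topology TG ?P) ?P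
     (\<lambda>w. (\<phi> (fst w) (fst (snd w)), \<psi> (fst w) (snd (snd w))))"
    using continuous_map_compose[OF continuous_map_snd continuous_map_fst, of TG X Y]
      continuous_map_compose[OF continuous_map_snd continuous_map_snd, of TG X Y]
    by (intro continuous_map_pairedI continuous_map_binop[OF D(7)] continuous_map_binop[OF D'(7)]
        continuous_map_fst) (simp_all add: o_def)
  then show "continuous_map (prod_topology TG ?P) ?P (\<lambda>(g, x). ?a g x)"
    by (rule continuous_map_eq) auto
  show "Hausdorff_space ?P" using D(2) D'(2) by (simp add: Hausdorff_space_prod_topology)
  show "group G" by (rule D(1))
qed (use G_spaceD[OF X] G_spaceD[OF Y] in auto)

lemma G_space_prod:
  assumes X: "G_space G TG X \<phi>" and T: "topspace TG = carrier G"
  shows "G_space (G \<times>\<times> G) (prod_topology TG TG) (prod_topology X X)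
           (prod_action (topspace X \<times> topspace X) \<phi>)"
    (is "G_space ?G ?T ?P ?a")
proof (rule G_spaceI)
  note D = G_spaceD[OF X]
  interpret group G by (rule D(1))
  have "continuous_map (prod_topology ?T ?P) ?P
     (\<lambda>w. (\<phi> (fst (fst w)) (fst (snd w)), \<phi> (snd (fst w)) (snd (snd w))))"
    using continuous_map_compose[OF continuous_map_snd continuous_map_fst, of ?T X X]
      continuous_map_compose[OF continuous_map_snd continuous_map_snd, of ?T X X]
      continuous_map_compose[OF continuous_map_fst continuous_map_fst, of TG TG ?P]
      continuous_map_compose[OF continuous_map_fst continuous_map_snd, of TG TG ?P]
    by (intro continuous_map_pairedI continuous_map_binop[OF D(7)]) (simp_all add: o_def)
  then show "continuous_map (prod_topology ?T ?P) ?P (\<lambda>(g, x). ?a g x)"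
    by (rule continuous_map_eq) (auto simp: prod_action_def)
  show "Hausdorff_space ?P" using D(2) by (simp add: Hausdorff_space_prod_topology)
  show "group ?G" using D(1) by (simp add: DirProd_group)
qed (use G_spaceD[OF X] in \<open>auto simp: prod_action_def DirProd_def\<close>)

text \<open>The test spaces built into \<open>G_fibration\<close> suffice: every \<open>G\<close>-space maps to the mapping path
  space \<open>{(e, \<beta>). \<beta> 0 = p e}\<close>, where the universal lifting problem lives.\<close>

theorem G_fibration_HLP:
  fixes Z :: "'z topology" and E :: "'e topology" and B :: "'b topology"
  assumes fib: "G_fibration G TG E \<phi> B \<psi> p" and T: "topspace TG = carrier G"
    and Z: "G_space G TG Z \<zeta>"
  shows "G_HLP G E \<phi> B \<psi> p Z \<zeta>"
  unfolding G_HLP_def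
proof (intro allI impI, elim conjE)
  fix f h
  assume f: "G_map G Z \<zeta> E \<phi> f" and h: "G_homotopy G Z \<zeta> B \<psi> h"
    and h0: "\<forall>z\<in>topspace Z. h (0, z) = p (f z)"
  have E: "G_space G TG E \<phi>" and B: "G_space G TG B \<psi>" and p: "G_map G E \<phi> B \<psi> p"
    using fib by (auto simp: G_fibration_def)
  note DE = G_spaceD[OF E] and DB = G_spaceD[OF B] and DZ = G_spaceD[OF Z]
  let ?M = "mapping_space I_top B"
  let ?S = "{(e, \<beta>). \<beta> 0 = p e}"
  define N where "N = subtopology (prod_topology E ?M) ?S"
  define \<nu> where "\<nu> = (\<lambda>g. restrict (\<lambda>(e, \<beta>). (\<phi> g e, path_action \<psi> g \<beta>)) (topspace N))"
  have tN: "topspace N = (topspace E \<times> topspace ?M) \<inter> ?S" by (simp add: N_def)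
  have N: "G_space G TG N \<nu>"
    unfolding N_def
    by (rule G_space_subtopology[OF G_space_diag[OF E G_space_paths[OF B T] T] T])
      (use p in \<open>auto simp: \<nu>_def tN path_action_def G_map_def equivariant_def\<close>)
  have pathB: "\<beta> t \<in> topspace B" if "\<beta> \<in> topspace ?M" "t \<in> {0..1}" for \<beta> t
    using that by (auto simp: topspace_mapping_space continuous_map_def)
  have cfst: "continuous_map N E fst"
    unfolding N_def by (intro continuous_map_from_subtopology continuous_map_fst)
  have csnd: "continuous_map N ?M snd"
    unfolding N_def by (intro continuous_map_from_subtopology continuous_map_snd)
  have fN: "G_map G N \<nu> E \<phi> fst"
    using cfst by (auto simp: G_map_def equivariant_def \<nu>_def)
  let ?H = "\<lambda>w. (\<lambda>(t, \<beta>). \<beta> t) (fst w, snd (snd w))"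
  have "continuous_map (prod_topology I_top N) ?M (\<lambda>w. snd (snd w))"
    using continuous_map_compose[OF continuous_map_snd csnd] by (simp add: o_def)
  then have "continuous_map (prod_topology I_top N) (prod_topology I_top ?M) (\<lambda>w. (fst w, snd (snd w)))"
    by (intro continuous_map_pairedI continuous_map_fst)
  from continuous_map_compose[OF this continuous_map_eval[OF I_top_props]]
  have "continuous_map (prod_topology I_top N) B ?H" by (simp add: o_def)
  then have hN: "G_homotopy G N \<nu> B \<psi> ?H"
    by (auto simp: G_homotopy_def G_map_def equivariant_def \<nu>_def path_action_def)
  have "G_HLP G E \<phi> B \<psi> p N \<nu>"
    using fib N unfolding G_fibration_def by blast
  moreover have "\<forall>z\<in>topspace N. ?H (0, z) = p (fst z)" by (auto simp: tN)
  ultimately obtain L where L: "G_homotopy G N \<nu> E \<phi> L" "\<forall>z\<in>topspace N. L (0, z) = fst z"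
      "\<forall>t\<in>{0..1}. \<forall>z\<in>topspace N. p (L (t, z)) = ?H (t, z)"
    using fN hN unfolding G_HLP_def by blast
  define F where "F = (\<lambda>z. (f z, \<lambda>t\<in>{0..1}. h (t, z)))"
  have hc: "continuous_map (prod_topology I_top Z) B h"
    and hequi: "\<And>g t z. \<lbrakk>g \<in> carrier G; t \<in> {0..1}; z \<in> topspace Z\<rbrakk> \<Longrightarrow> h (t, \<zeta> g z) = \<psi> g (h (t, z))"
    using h by (auto simp: G_homotopy_def G_map_def equivariant_def)
  have fc: "continuous_map Z E f"
    and fequi: "\<And>g z. \<lbrakk>g \<in> carrier G; z \<in> topspace Z\<rbrakk> \<Longrightarrow> f (\<zeta> g z) = \<phi> g (f z)"
    using f by (auto simp: G_map_def equivariant_def)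
  have "continuous_map Z ?M (\<lambda>z. \<lambda>t\<in>{0..1}. h (t, z))"
    using continuous_map_curry[OF hc] by simp
  then have Fc: "continuous_map Z N F"
    unfolding N_def F_def
    by (intro continuous_map_into_subtopology continuous_map_pairedI fc) (use h0 in auto)
  then have FN: "F z \<in> topspace N" if "z \<in> topspace Z" for z
    using that by (auto simp: continuous_map_def)
  have Fequi: "F (\<zeta> g z) = \<nu> g (F z)" if "g \<in> carrier G" "z \<in> topspace Z" for g z
    using FN[OF that(2)] that fequi hequi
    by (auto simp: \<nu>_def F_def path_action_def fun_eq_iff)
  define k where "k = (\<lambda>w. L (fst w, F (snd w)))"
  have Lc: "continuous_map (prod_topology I_top N) E L"
    and Lequi: "\<And>g t z. \<lbrakk>g \<in> carrier G; t \<in> {0..1}; z \<in> topspace N\<rbrakk> \<Longrightarrow> L (t, \<nu> g z) = \<phi> g (L (t, z))"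
    using L(1) by (auto simp: G_homotopy_def G_map_def equivariant_def)
  have "continuous_map (prod_topology I_top Z) N (\<lambda>w. F (snd w))"
    using continuous_map_compose[OF continuous_map_snd Fc] by (simp add: o_def)
  then have "continuous_map (prod_topology I_top Z) (prod_topology I_top N) (\<lambda>w. (fst w, F (snd w)))"
    by (intro continuous_map_pairedI continuous_map_fst)
  from continuous_map_compose[OF this Lc] have "continuous_map (prod_topology I_top Z) E k"
    by (simp add: k_def o_def)
  then have "G_homotopy G Z \<zeta> E \<phi> k"
    using Lequi Fequi FN by (auto simp: G_homotopy_def G_map_def equivariant_def k_def)
  moreover have "\<forall>z\<in>topspace Z. k (0, z) = f z"
    using L(2) FN by (auto simp: k_def F_def)
  moreover have "\<forall>t\<in>{0..1}. \<forall>z\<in>topspace Z. p (k (t, z)) = h (t, z)"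
    using L(3) FN by (auto simp: k_def F_def)
  ultimately show "\<exists>k. G_homotopy G Z \<zeta> E \<phi> k \<and> (\<forall>z\<in>topspace Z. k (0, z) = f z) \<and>
             (\<forall>t\<in>{0..1}. \<forall>z\<in>topspace Z. p (k (t, z)) = h (t, z))" by blast
qed

lemma orbit_act:
  assumes "G_space G TG X \<phi>" "g \<in> carrier G" "x \<in> topspace X"
  shows "orbit G \<phi> (\<phi> g x) = orbit G \<phi> x"
proof -
  note D = G_spaceD[OF assms(1)]
  interpret group G by (rule D(1))
  show ?thesis
  proof (intro equalityI subsetI)
    fix y assume "y \<in> orbit G \<phi> (\<phi> g x)"
    then obtain h where h: "h \<in> carrier G" "y = \<phi> h (\<phi> g x)" by (auto simp: orbit_def)
    then have "y = \<phi> (h \<otimes>\<^bsub>G\<^esub> g) x" using D(6) assms by simp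
    then show "y \<in> orbit G \<phi> x" unfolding orbit_def using h(1) assms(2) by blast
  next
    fix y assume "y \<in> orbit G \<phi> x"
    then obtain h where h: "h \<in> carrier G" "y = \<phi> h x" by (auto simp: orbit_def)
    then have "y = \<phi> (h \<otimes>\<^bsub>G\<^esub> inv\<^bsub>G\<^esub> g) (\<phi> g x)"
      using D(6)[of "h \<otimes>\<^bsub>G\<^esub> inv\<^bsub>G\<^esub> g" g x] assms by (simp add: m_assoc)
    moreover have "h \<otimes>\<^bsub>G\<^esub> inv\<^bsub>G\<^esub> g \<in> carrier G" using h(1) assms(2) by simp
    ultimately show "y \<in> orbit G \<phi> (\<phi> g x)" unfolding orbit_def by blast
  qed
qed

text \<open>The spaces between which \<open>\<Psi>\<close> runs are \<open>G \<times> G\<close>-spaces.\<close>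

lemma G_space_inv_base_space:
  assumes E: "G_space G TG E \<phi>" and B: "G_space G TG B \<psi>" and p: "G_map G E \<phi> B \<psi> p"
    and T: "topspace TG = carrier G"
  shows "G_space (G \<times>\<times> G) (prod_topology TG TG) (inv_base_space G E \<psi> p) (inv_base_action G E \<phi> \<psi> p)"
proof -
  have pE: "p e \<in> topspace B" if "e \<in> topspace E" for e
    using p that by (auto simp: G_map_def continuous_map_def)
  show ?thesis
    unfolding inv_base_space_def
    by (rule G_space_subtopology[OF G_space_prod[OF E T]])
      (use p T orbit_act[OF B] pE in \<open>auto simp: inv_base_action_def inv_base_space_def prod_action_def
          DirProd_def G_map_def equivariant_def\<close>)
qed

lemma G_space_fibre_paths:
  assumes E: "G_space G TG E \<phi>" and B: "G_space G TG B \<psi>" and p: "G_map G E \<phi> B \<psi> p"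
    and T: "topspace TG = carrier G"
  shows "G_space G TG (fibre_paths E B p)
           (\<lambda>g. restrict (path_action \<phi> g) (topspace (fibre_paths E B p)))"
proof -
  note DB = G_spaceD[OF B]
  have pt: "\<gamma> t \<in> topspace E" if "\<gamma> \<in> topspace (mapping_space I_top E)" "0 \<le> t" "t \<le> 1" for \<gamma> t
    using that by (auto simp: topspace_mapping_space continuous_map_def)
  show ?thesis
    unfolding fibre_paths_def
  proof (rule G_space_subtopology[OF G_space_paths[OF E T] T], goal_cases)
    case (1 g \<gamma>)
    then obtain b where "b \<in> topspace B" "\<forall>t\<in>{0..1}. p (\<gamma> t) = b" by auto
    with 1 have "\<psi> g b \<in> topspace B" "\<forall>t\<in>{0..1}. p (path_action \<phi> g \<gamma> t) = \<psi> g b"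
      using DB(3) p pt by (auto simp: path_action_def G_map_def equivariant_def)
    with 1 show ?case by auto
  qed auto
qed

lemma G_space_inv_path_space:
  assumes E: "G_space G TG E \<phi>" and B: "G_space G TG B \<psi>" and p: "G_map G E \<phi> B \<psi> p"
    and T: "topspace TG = carrier G"
  shows "G_space (G \<times>\<times> G) (prod_topology TG TG) (inv_path_space G E \<phi> B p) (inv_path_action G E \<phi> B p)"
proof -
  have pt: "\<gamma> t \<in> topspace E" if "\<gamma> \<in> topspace (fibre_paths E B p)" "0 \<le> t" "t \<le> 1" for \<gamma> t
    using that by (auto simp: fibre_paths_def topspace_mapping_space continuous_map_def)
  show ?thesis
    unfolding inv_path_space_def
    by (rule G_space_subtopology[OF G_space_prod[OF G_space_fibre_paths[OF E B p T] T]])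
      (use T orbit_act[OF E] pt in \<open>auto simp: inv_path_action_def inv_path_space_def prod_action_def
          path_action_def DirProd_def\<close>)
qed

end

theory Submission
  imports Defs
begin

text \<open>The inequality is a restriction argument. Write \<open>Y\<^sub>G\<close> and \<open>Y\<^sub>K\<close> for the base spaces
  \<open>E \<times>\<^bsub>B/G\<^esub> E\<close> and \<open>E \<times>\<^bsub>B/K\<^esub> E\<close>, so that \<open>Y\<^sub>K \<subseteq> Y\<^sub>G\<close>. One would like to intersect a cover of
  \<open>Y\<^sub>G\<close> by domains of local sections with \<open>Y\<^sub>K\<close>, and two points need an argument.

  First, the restricted sections must take values in the \<open>K\<close>-version of the total space. This is where
  freeness enters. Let \<open>(\<gamma>, \<delta>)\<close> lie over \<open>Y\<^sub>K\<close>, say \<open>\<gamma> 1 = g \<cdot> \<delta> 0\<close> with \<open>g \<in> G\<close> and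
  \<open>p (\<gamma> 0) = k \<cdot> p (\<delta> 1)\<close> with \<open>k \<in> K\<close>. Both paths stay in one fibre, so
  \<open>g \<cdot> p (\<delta> 0) = k \<cdot> p (\<delta> 0)\<close> and hence \<open>g = k \<in> K\<close>. The \<open>K\<close>-version of \<open>\<Psi>\<close> is therefore the
  restriction of the \<open>G\<close>-version to the full preimage of \<open>Y\<^sub>K\<close>
  (\<open>inv_path_space_subgroup\<close>, \<open>inv_base_space_subgroup\<close>).

  Second, a section \<open>s\<close> over \<open>U\<close> is only a section up to a homotopy in \<open>Y\<^sub>G\<close>, which may leave \<open>Y\<^sub>K\<close> even
  over points of \<open>Y\<^sub>K\<close>. Since \<open>\<Psi>\<close> is a fibration, the homotopy lifts, and the end of the lift is
  a strict section (\<open>G_fibration_strict_section\<close>). Strict sections do restrict to every invariant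
  subspace, also along a change to a subgroup (\<open>secat_restrict_le\<close>).\<close>

section \<open>Sectional category of a restricted fibration\<close>

text \<open>The homotopy from \<open>q \<circ> s\<close> to the inclusion is lifted, starting at \<open>s\<close>; the lift at time
  1 lies over the inclusion itself.\<close>

lemma G_fibration_strict_section:
  assumes fib: "G_fibration G TG X \<phi> Y \<psi> q" and T: "topspace TG = carrier G"
    and U: "U \<subseteq> topspace Y" and inv: "\<And>g. g \<in> carrier G \<Longrightarrow> \<psi> g ` U \<subseteq> U"
    and s: "G_map G (subtopology Y U) \<psi> X \<phi> s"
    and hom: "homotopic_with (equivariant G U \<psi> \<psi>) (subtopology Y U) Y (q \<circ> s) id"
  obtains \<sigma> where "G_map G (subtopology Y U) \<psi> X \<phi> \<sigma>" "\<And>y. y \<in> U \<Longrightarrow> q (\<sigma> y) = y"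
proof -
  let ?Z = "subtopology Y U"
  \<comment> \<open>The action on a \<open>G\<close>-space must be \<open>undefined\<close> off that space.\<close>
  define \<zeta> where "\<zeta> g = restrict (\<psi> g) U" for g
  have tZ: "topspace ?Z = U" using U by auto
  have Y: "G_space G TG Y \<psi>" using fib by (simp add: G_fibration_def)
  have "G_space G TG ?Z \<zeta>"
  proof (rule G_space_subtopology[OF Y T])
    show "\<zeta> g \<in> extensional (topspace Y \<inter> U)" for g
      using U by (simp add: \<zeta>_def Int_absorb1)
  qed (use inv in \<open>auto simp: \<zeta>_def\<close>)
  then have HLP: "G_HLP G X \<phi> Y \<psi> q ?Z \<zeta>" by (rule G_fibration_HLP[OF fib T])
  obtain h where hc: "continuous_map (prod_topology I_top ?Z) Y h"
    and h0: "\<And>y. h (0, y) = q (s y)" and h1: "\<And>y. h (1, y) = y"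
    and hequi: "\<And>t. t \<in> {0..1} \<Longrightarrow> equivariant G U \<psi> \<psi> (\<lambda>y. h (t, y))"
    using hom unfolding homotopic_with_def by auto
  have "G_map G ?Z \<zeta> X \<phi> s"
    using s tZ by (auto simp: G_map_def equivariant_def \<zeta>_def)
  moreover have "G_homotopy G ?Z \<zeta> Y \<psi> h"
    using hc hequi tZ by (auto simp: G_homotopy_def G_map_def equivariant_def \<zeta>_def)
  ultimately obtain k where k: "G_homotopy G ?Z \<zeta> X \<phi> k"
      "\<And>t y. t \<in> {0..1} \<Longrightarrow> y \<in> U \<Longrightarrow> q (k (t, y)) = h (t, y)"
    using HLP h0 unfolding G_HLP_def tZ by metis
  have kc: "continuous_map (prod_topology I_top ?Z) X k"
    and kequi: "\<And>g t y. \<lbrakk>g \<in> carrier G; t \<in> {0..1}; y \<in> U\<rbrakk> \<Longrightarrow> k (t, \<psi> g y) = \<phi> g (k (t, y))"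
    using k(1) tZ by (auto simp: G_homotopy_def G_map_def equivariant_def \<zeta>_def)
  show ?thesis
  proof
    have "continuous_map ?Z X (k \<circ> Pair 1)"
      by (rule continuous_map_o_Pair[OF kc]) simp
    then show "G_map G ?Z \<psi> X \<phi> (\<lambda>y. k (1, y))"
      using kequi tZ by (simp add: G_map_def equivariant_def o_def)
    show "q (k (1, y)) = y" if "y \<in> U" for y
      using k(2) h1 that by simp
  qed
qed

text \<open>A strict section over \<open>U\<close> maps \<open>U \<inter> S\<close> into the preimage of \<open>S\<close>, so that a cover for \<open>q\<close>,
  intersected with \<open>S\<close>, serves the restriction of \<open>q\<close> over \<open>S\<close>, with constant homotopies. Only
  equivariance is compared, so the smaller group enters through its carrier alone, and \<open>S\<close> may be
  invariant under it without being invariant under \<open>G\<close>.\<close>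

lemma secat_restrict_le:
  assumes fib: "G_fibration G TG X \<phi> Y \<psi> q" and T: "topspace TG = carrier G"
    and H: "carrier H \<subseteq> carrier G"
    and S: "\<And>g y. \<lbrakk>g \<in> carrier H; y \<in> topspace Y; y \<in> S\<rbrakk> \<Longrightarrow> \<psi> g y \<in> S"
    and \<phi>': "\<And>g x. \<lbrakk>g \<in> carrier H; x \<in> topspace X; q x \<in> S\<rbrakk> \<Longrightarrow> \<phi>' g x = \<phi> g x"
    and \<psi>': "\<And>g y. \<lbrakk>g \<in> carrier H; y \<in> topspace Y; y \<in> S\<rbrakk> \<Longrightarrow> \<psi>' g y = \<psi> g y"
  shows "secat H (subtopology X (q -` S)) \<phi>' (subtopology Y S) \<psi>' q \<le> secat G X \<phi> Y \<psi> q"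
proof -
  let ?X = "subtopology X (q -` S)" and ?Y = "subtopology Y S"
  have restricted: "\<exists>V \<sigma>. (\<Union>i<k. V i) = topspace ?Y \<and>
        (\<forall>i<k. openin ?Y (V i) \<and> (\<forall>g\<in>carrier H. \<psi>' g ` V i \<subseteq> V i) \<and>
           G_map H (subtopology ?Y (V i)) \<psi>' ?X \<phi>' (\<sigma> i) \<and>
           homotopic_with (equivariant H (V i) \<psi>' \<psi>') (subtopology ?Y (V i)) ?Y (q \<circ> \<sigma> i) id)"
    if cover: "(\<Union>i<k. U i) = topspace Y"
      and sec: "\<And>i. i < k \<Longrightarrow> openin Y (U i) \<and> (\<forall>g\<in>carrier G. \<psi> g ` U i \<subseteq> U i) \<and>
           G_map G (subtopology Y (U i)) \<psi> X \<phi> (s i) \<and>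
           homotopic_with (equivariant G (U i) \<psi> \<psi>) (subtopology Y (U i)) Y (q \<circ> s i) id"
    for k :: nat and U s
  proof -
    have UY: "U i \<subseteq> topspace Y" if "i < k" for i
      using sec[OF that] openin_subset by blast
    have "\<forall>i\<in>{..<k}. \<exists>\<sigma>. G_map G (subtopology Y (U i)) \<psi> X \<phi> \<sigma> \<and> (\<forall>y\<in>U i. q (\<sigma> y) = y)"
    proof
      fix i assume "i \<in> {..<k}"
      then have i: "i < k" by simp
      obtain \<sigma> where "G_map G (subtopology Y (U i)) \<psi> X \<phi> \<sigma>" "\<And>y. y \<in> U i \<Longrightarrow> q (\<sigma> y) = y"
        by (rule G_fibration_strict_section[OF fib T UY[OF i], where s = "s i"])
          (use sec[OF i] in auto)
      then show "\<exists>\<sigma>. G_map G (subtopology Y (U i)) \<psi> X \<phi> \<sigma> \<and> (\<forall>y\<in>U i. q (\<sigma> y) = y)" by blast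
    qed
    then obtain \<sigma> where \<sigma>: "\<And>i. i < k \<Longrightarrow> G_map G (subtopology Y (U i)) \<psi> X \<phi> (\<sigma> i)"
      and q\<sigma>: "\<And>i y. i < k \<Longrightarrow> y \<in> U i \<Longrightarrow> q (\<sigma> i y) = y"
      unfolding bchoice_iff by auto
    define V where "V i = U i \<inter> S" for i
    have "(\<Union>i<k. V i) = topspace ?Y"
      using cover by (auto simp: V_def)
    moreover have "openin ?Y (V i) \<and> (\<forall>g\<in>carrier H. \<psi>' g ` V i \<subseteq> V i) \<and>
           G_map H (subtopology ?Y (V i)) \<psi>' ?X \<phi>' (\<sigma> i) \<and>
           homotopic_with (equivariant H (V i) \<psi>' \<psi>') (subtopology ?Y (V i)) ?Y (q \<circ> \<sigma> i) id"
      if i: "i < k" for i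
    proof (intro conjI)
      have V: "y \<in> U i" "y \<in> topspace Y" "y \<in> S" if "y \<in> V i" for y
        using that UY[OF i] by (auto simp: V_def)
      have sub: "subtopology ?Y (V i) = subtopology Y (V i)"
        by (simp add: subtopology_subtopology V_def Int_absorb1)
      have tV: "topspace (subtopology Y (V i)) = V i"
        using V by auto
      show "openin ?Y (V i)"
        using sec[OF i] unfolding V_def by (auto simp: openin_subtopology)
      have inv: "\<psi>' g y \<in> V i" if "g \<in> carrier H" "y \<in> V i" for g y
        using sec[OF i] H S[of g y] \<psi>'[of g y] that V[OF that(2)] by (auto simp: V_def)
      then show "\<forall>g\<in>carrier H. \<psi>' g ` V i \<subseteq> V i" by blast
      have c: "continuous_map (subtopology Y (U i)) X (\<sigma> i)"
        and equi: "\<And>g y. \<lbrakk>g \<in> carrier G; y \<in> U i\<rbrakk> \<Longrightarrow> \<sigma> i (\<psi> g y) = \<phi> g (\<sigma> i y)"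
        using \<sigma>[OF i] UY[OF i] by (auto simp: G_map_def equivariant_def)
      have "continuous_map (subtopology Y (V i)) X (\<sigma> i)"
        by (rule continuous_map_from_subtopology_mono[OF c]) (simp add: V_def)
      moreover from this have \<sigma>X: "\<sigma> i y \<in> topspace X" if "y \<in> V i" for y
        using that tV by (auto simp: continuous_map_def)
      ultimately have "continuous_map (subtopology Y (V i)) ?X (\<sigma> i)"
        using tV V q\<sigma>[OF i] by (auto intro!: continuous_map_into_subtopology)
      moreover have "\<sigma> i (\<psi>' g y) = \<phi>' g (\<sigma> i y)" if "g \<in> carrier H" "y \<in> V i" for g y
        using that V[OF that(2)] H \<phi>'[of g "\<sigma> i y"] \<psi>'[of g y] equi[of g y] \<sigma>X[of y] q\<sigma>[OF i, of y] by auto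
      ultimately show "G_map H (subtopology ?Y (V i)) \<psi>' ?X \<phi>' (\<sigma> i)"
        unfolding sub by (auto simp: G_map_def equivariant_def tV)
      show "homotopic_with (equivariant H (V i) \<psi>' \<psi>') (subtopology ?Y (V i)) ?Y (q \<circ> \<sigma> i) id"
        \<comment> \<open>The homotopy is reversed because \<open>homotopic_with_equal\<close> asks for continuity of the first
          map, which is immediate for the inclusion.\<close>
      proof (rule homotopic_with_symD, rule homotopic_with_equal)
        show "equivariant H (V i) \<psi>' \<psi>' id" by (simp add: equivariant_def)
        show "equivariant H (V i) \<psi>' \<psi>' (q \<circ> \<sigma> i)"
          using inv V q\<sigma>[OF i] by (simp add: equivariant_def)
        show "continuous_map (subtopology ?Y (V i)) ?Y id"
          by (simp add: continuous_map_from_subtopology)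
        show "id y = (q \<circ> \<sigma> i) y" if "y \<in> topspace (subtopology ?Y (V i))" for y
          using that V q\<sigma>[OF i] by (simp add: sub tV)
      qed
    qed
    ultimately show ?thesis by blast
  qed
  show ?thesis
    unfolding secat_def
  proof (rule Inf_superset_mono, rule subsetI, elim CollectE exE conjE)
    fix n k U s
    assume n: "n = enat k" and "0 < k" and "(\<Union>i<k. U i) = topspace Y"
      and "\<forall>i<k. openin Y (U i) \<and> (\<forall>g\<in>carrier G. \<psi> g ` U i \<subseteq> U i) \<and>
           G_map G (subtopology Y (U i)) \<psi> X \<phi> (s i) \<and>
           homotopic_with (equivariant G (U i) \<psi> \<psi>) (subtopology Y (U i)) Y (q \<circ> s i) id"
    then show "n \<in> {enat k | k. k > 0 \<and>
     (\<exists>V \<sigma>. (\<Union>i<k. V i) = topspace ?Y \<and>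
        (\<forall>i<k. openin ?Y (V i) \<and> (\<forall>g\<in>carrier H. \<psi>' g ` V i \<subseteq> V i) \<and>
           G_map H (subtopology ?Y (V i)) \<psi>' ?X \<phi>' (\<sigma> i) \<and>
           homotopic_with (equivariant H (V i) \<psi>' \<psi>') (subtopology ?Y (V i)) ?Y (q \<circ> \<sigma> i) id))}"
      by (intro CollectI exI[of _ k] conjI n restricted[where U = U and s = s]) simp_all
  qed
qed

section \<open>Passing to a subgroup under a free action\<close>

lemma orbit_eq_iff:
  assumes X: "G_space G TG X \<phi>" and x: "x \<in> topspace X" "y \<in> topspace X"
  shows "orbit G \<phi> x = orbit G \<phi> y \<longleftrightarrow> (\<exists>g\<in>carrier G. x = \<phi> g y)"
proof
  note D = G_spaceD[OF X]
  interpret group G by (rule D(1))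
  assume "orbit G \<phi> x = orbit G \<phi> y"
  moreover have "x \<in> orbit G \<phi> x"
    unfolding orbit_def using D(5)[OF x(1)] one_closed by (metis (mono_tags, lifting) mem_Collect_eq)
  ultimately show "\<exists>g\<in>carrier G. x = \<phi> g y" by (auto simp: orbit_def)
next
  assume "\<exists>g\<in>carrier G. x = \<phi> g y"
  then show "orbit G \<phi> x = orbit G \<phi> y" using orbit_act[OF X _ x(2)] by auto
qed

lemma act_cancel_stabilizer:
  assumes X: "G_space G TG X \<phi>" and x: "x \<in> topspace X" and free: "stabilizer G \<phi> x = {\<one>\<^bsub>G\<^esub>}"
    and gh: "g \<in> carrier G" "h \<in> carrier G" "\<phi> g x = \<phi> h x"
  shows "g = h"
proof -
  note D = G_spaceD[OF X]
  interpret group G by (rule D(1))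
  have "\<phi> (inv\<^bsub>G\<^esub> h \<otimes>\<^bsub>G\<^esub> g) x = \<phi> (inv\<^bsub>G\<^esub> h \<otimes>\<^bsub>G\<^esub> h) x"
    using D(6)[of "inv\<^bsub>G\<^esub> h" g x] D(6)[of "inv\<^bsub>G\<^esub> h" h x] gh x by simp
  then have "inv\<^bsub>G\<^esub> h \<otimes>\<^bsub>G\<^esub> g \<in> stabilizer G \<phi> x"
    using gh D(5)[OF x] by (simp add: stabilizer_def)
  then show "g = h" using free gh by (metis inv_closed inv_equality inv_inv singletonD)
qed

lemma G_space_subgroup:
  assumes X: "G_space G TG X \<phi>" and T: "topspace TG = carrier G" and K: "subgroup K G"
  shows "G_space (G\<lparr>carrier := K\<rparr>) (subtopology TG K) X \<phi>"
proof (rule G_spaceI)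
  note D = G_spaceD[OF X]
  interpret group G by (rule D(1))
  show "group (G\<lparr>carrier := K\<rparr>)" using K by (rule subgroup.subgroup_is_group) (rule D(1))
  have "continuous_map (prod_topology (subtopology TG K) X) X (\<lambda>(g, x). \<phi> g x)"
    using continuous_map_from_subtopology[OF D(7), of "K \<times> topspace X"]
    by (simp add: prod_topology_subtopology)
  then show "continuous_map (prod_topology (subtopology TG K) X) X (\<lambda>(g, x). \<phi> g x)" .
qed (use G_spaceD[OF X] subgroup.mem_carrier[OF K] in auto)

text \<open>An element \<open>g\<close> relating \<open>e\<close> to \<open>e'\<close> also relates \<open>p e\<close> to
  \<open>p e'\<close>, and no other element does, by freeness. So it lies in \<open>K\<close> as soon as \<open>p e\<close> and \<open>p e'\<close> are in one \<open>K\<close>-orbit.\<close>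

lemma orbit_subgroup_eq_iff:
  assumes E: "G_space G TG E \<phi>" and B: "G_space G TG B \<psi>" and p: "G_map G E \<phi> B \<psi> p"
    and T: "topspace TG = carrier G" and K: "subgroup K G"
    and free: "\<And>b. b \<in> topspace B \<Longrightarrow> stabilizer G \<psi> b = {\<one>\<^bsub>G\<^esub>}"
    and e: "e \<in> topspace E" "e' \<in> topspace E"
  shows "orbit (G\<lparr>carrier := K\<rparr>) \<phi> e = orbit (G\<lparr>carrier := K\<rparr>) \<phi> e' \<longleftrightarrow>
    orbit G \<phi> e = orbit G \<phi> e' \<and>
    orbit (G\<lparr>carrier := K\<rparr>) \<psi> (p e) = orbit (G\<lparr>carrier := K\<rparr>) \<psi> (p e')"
proof -
  note EK = G_space_subgroup[OF E T K] and BK = G_space_subgroup[OF B T K]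
  have pB: "p e \<in> topspace B" "p e' \<in> topspace B"
    using p e by (auto simp: G_map_def continuous_map_def)
  have pequi: "p (\<phi> g e') = \<psi> g (p e')" if "g \<in> carrier G" for g
    using p e(2) that by (auto simp: G_map_def equivariant_def)
  have KG: "k \<in> carrier G" if "k \<in> K" for k using subgroup.mem_carrier[OF K that] .
  have "(\<exists>k\<in>K. e = \<phi> k e') \<longleftrightarrow>
      (\<exists>g\<in>carrier G. e = \<phi> g e') \<and> (\<exists>k\<in>K. p e = \<psi> k (p e'))"
    using pequi KG act_cancel_stabilizer[OF B pB(2) free[OF pB(2)]] by metis
  then show ?thesis
    using orbit_eq_iff[OF EK e] orbit_eq_iff[OF E e] orbit_eq_iff[OF BK pB] by simp
qed

lemma subtopology_cong_on_topspace:
  assumes "topspace X \<inter> S = topspace X \<inter> T"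
  shows "subtopology X S = subtopology X T"
  using assms by (metis subtopology_restrict)

lemma inv_base_space_subgroup:
  assumes B: "G_space G TG B \<psi>" and p: "continuous_map E B p"
    and T: "topspace TG = carrier G" and K: "subgroup K G"
  shows "inv_base_space (G\<lparr>carrier := K\<rparr>) E \<psi> p =
    subtopology (inv_base_space G E \<psi> p)
      {(e, e'). orbit (G\<lparr>carrier := K\<rparr>) \<psi> (p e) = orbit (G\<lparr>carrier := K\<rparr>) \<psi> (p e')}"
proof -
  note BK = G_space_subgroup[OF B T K]
  have "orbit G \<psi> b = orbit G \<psi> b'"
    if "orbit (G\<lparr>carrier := K\<rparr>) \<psi> b = orbit (G\<lparr>carrier := K\<rparr>) \<psi> b'"
      and b: "b \<in> topspace B" "b' \<in> topspace B" for b b'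
    using that(1) subgroup.mem_carrier[OF K]
    unfolding orbit_eq_iff[OF BK b] orbit_eq_iff[OF B b] by auto
  moreover have "p e \<in> topspace B" if "e \<in> topspace E" for e
    using p that by (auto simp: continuous_map_def)
  ultimately show ?thesis
    unfolding inv_base_space_def subtopology_subtopology
    by (intro subtopology_cong_on_topspace) auto
qed

text \<open>The \<open>K\<close>-version of the total space is the full preimage under \<open>\<Psi>\<close> of the \<open>K\<close>-version of the
  base space: since \<open>p \<circ> \<gamma>\<close> and \<open>p \<circ> \<delta>\<close> are constant, the condition on \<open>(\<gamma> 0, \<delta> 1)\<close> is one on
  \<open>(\<gamma> 1, \<delta> 0)\<close>, where \<open>orbit_subgroup_eq_iff\<close> applies.\<close>

lemma inv_path_space_subgroup:
  assumes E: "G_space G TG E \<phi>" and B: "G_space G TG B \<psi>" and p: "G_map G E \<phi> B \<psi> p"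
    and T: "topspace TG = carrier G" and K: "subgroup K G"
    and free: "\<And>b. b \<in> topspace B \<Longrightarrow> stabilizer G \<psi> b = {\<one>\<^bsub>G\<^esub>}"
  shows "inv_path_space (G\<lparr>carrier := K\<rparr>) E \<phi> B p =
    subtopology (inv_path_space G E \<phi> B p)
      (Psi -` {(e, e'). orbit (G\<lparr>carrier := K\<rparr>) \<psi> (p e) = orbit (G\<lparr>carrier := K\<rparr>) \<psi> (p e')})"
proof -
  have pt: "\<gamma> t \<in> topspace E" if "\<gamma> \<in> topspace (fibre_paths E B p)" "t \<in> {0..1}" for \<gamma> t
    using that by (auto simp: fibre_paths_def topspace_mapping_space continuous_map_def)
  have const: "p (\<gamma> 0) = p (\<gamma> 1)" if "\<gamma> \<in> topspace (fibre_paths E B p)" for \<gamma>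
    using that by (auto simp: fibre_paths_def)
  have iff: "orbit (G\<lparr>carrier := K\<rparr>) \<phi> (\<gamma> 1) = orbit (G\<lparr>carrier := K\<rparr>) \<phi> (\<delta> 0) \<longleftrightarrow>
      orbit G \<phi> (\<gamma> 1) = orbit G \<phi> (\<delta> 0) \<and>
      orbit (G\<lparr>carrier := K\<rparr>) \<psi> (p (\<gamma> 0)) = orbit (G\<lparr>carrier := K\<rparr>) \<psi> (p (\<delta> 1))"
    if "\<gamma> \<in> topspace (fibre_paths E B p)" "\<delta> \<in> topspace (fibre_paths E B p)" for \<gamma> \<delta>
    using orbit_subgroup_eq_iff[OF E B p T K free, of "\<gamma> 1" "\<delta> 0"]
      pt[OF that(1), of 1] pt[OF that(2), of 0] const[OF that(1)] const[OF that(2)] by simp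
  show ?thesis
    unfolding inv_path_space_def subtopology_subtopology
    by (intro subtopology_cong_on_topspace equalityI subrelI; simp add: Psi_def; use iff in blast)
qed

section \<open>Monotonicity of the invariant parametrized topological complexity\<close>

theorem proposition4p12:
  fixes G :: "('g, 'm) monoid_scheme" and TG :: "'g topology" and K :: "'g set"
    and E :: "'e topology" and \<phi> :: "'g \<Rightarrow> 'e \<Rightarrow> 'e"
    and B :: "'b topology" and \<psi> :: "'g \<Rightarrow> 'b \<Rightarrow> 'b" and p :: "'e \<Rightarrow> 'b"
  assumes "topological_group G TG"
    and "G_fibration G TG E \<phi> B \<psi> p"
    and "Psi_fibration G TG E \<phi> B \<psi> p"
    and "\<forall>b\<in>topspace B. stabilizer G \<psi> b = {\<one>\<^bsub>G\<^esub>}"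
    and "subgroup K G"
    and "G_fibration (G\<lparr>carrier := K\<rparr>) (subtopology TG K) E \<phi> B \<psi> p"
  shows "invTC (G\<lparr>carrier := K\<rparr>) E \<phi> B \<psi> p \<le> invTC G E \<phi> B \<psi> p"
proof -
  let ?K = "G\<lparr>carrier := K\<rparr>"
  let ?S = "{(e, e'). orbit ?K \<psi> (p e) = orbit ?K \<psi> (p e')}"
  let ?X = "inv_path_space G E \<phi> B p" and ?Y = "inv_base_space G E \<psi> p"
  have T: "topspace TG = carrier G" using assms(1) by (simp add: topological_group_def)
  have TT: "topspace (prod_topology TG TG) = carrier (G \<times>\<times> G)"
    by (simp add: T DirProd_def)
  have E: "G_space G TG E \<phi>" and B: "G_space G TG B \<psi>" and p: "G_map G E \<phi> B \<psi> p"
    using assms(2) by (auto simp: G_fibration_def)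
  have KG: "K \<subseteq> carrier G" by (rule subgroup.subset[OF assms(5)])
  have Y: "inv_base_space ?K E \<psi> p = subtopology ?Y ?S"
    using inv_base_space_subgroup[OF B _ T assms(5), of E p] p by (simp add: G_map_def)
  have X: "inv_path_space ?K E \<phi> B p = subtopology ?X (Psi -` ?S)"
    using inv_path_space_subgroup[OF E B p T assms(5)] assms(4) by simp
  note EK = G_space_subgroup[OF E T assms(5)] and BK = G_space_subgroup[OF B T assms(5)]
  have TK: "topspace (subtopology TG K) = carrier ?K" using T KG by auto
  have pK: "G_map ?K E \<phi> B \<psi> p"
    using p KG by (auto simp: G_map_def equivariant_def)
  have YK: "G_space (?K \<times>\<times> ?K) (prod_topology (subtopology TG K) (subtopology TG K))
      (inv_base_space ?K E \<psi> p) (inv_base_action ?K E \<phi> \<psi> p)"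
    by (rule G_space_inv_base_space[OF EK BK pK TK])
  have act: "inv_base_action ?K E \<phi> \<psi> p g y = inv_base_action G E \<phi> \<psi> p g y"
    if "y \<in> topspace ?Y" "y \<in> ?S" for g y
    using that by (simp add: inv_base_action_def prod_action_def Y)
  show ?thesis
    unfolding invTC_def X Y
  proof (rule secat_restrict_le[OF _ TT])
    show "G_fibration (G \<times>\<times> G) (prod_topology TG TG) ?X (inv_path_action G E \<phi> B p)
        ?Y (inv_base_action G E \<phi> \<psi> p) Psi"
      using assms(3) by (simp add: Psi_fibration_def)
    show "carrier (?K \<times>\<times> ?K) \<subseteq> carrier (G \<times>\<times> G)"
      using KG by (auto simp: DirProd_def)
    \<comment> \<open>On \<open>?S\<close> the action is that of the \<open>K \<times> K\<close>-space \<open>inv_base_space ?K E \<psi> p\<close>.\<close>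
    show "inv_base_action G E \<phi> \<psi> p g y \<in> ?S"
      if "g \<in> carrier (?K \<times>\<times> ?K)" "y \<in> topspace ?Y" "y \<in> ?S" for g y
      using G_spaceD(3)[OF YK that(1), of y] that(2,3) act[OF that(2,3)] by (simp add: Y)
    show "inv_path_action ?K E \<phi> B p g x = inv_path_action G E \<phi> B p g x"
      if "x \<in> topspace ?X" "Psi x \<in> ?S" for g x
      using that by (simp add: inv_path_action_def prod_action_def X)
    show "inv_base_action ?K E \<phi> \<psi> p g y = inv_base_action G E \<phi> \<psi> p g y"
      if "y \<in> topspace ?Y" "y \<in> ?S" for g y
      using that by (rule act)
  qed
qed

end
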